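(* Let $n\in\mathbb{N}\cup\{\infty\}$, let $(G,+,0)$ be an abelian group, let $\mathbf{c}=(c_i)_{i\in\mathbb{Z}_n}$ be a sequence in $G$ with $c_0=0$ such that $\{c_i\mid i\in\mathbb{Z}_n\}$ generates $G$, and let $(X,\sigma,\tau)=\mathcal{S}(G\times\mathbb{Z}_n,\mathbf{c})$. An equivalence relation $\asymp$ on $X=G\times\mathbb{Z}_n$ is a congruence of $(X,\sigma,\tau)$ if and only if there exist a subgroup $H$ of $G$, $m\in\mathbb{N}\cup\{\infty\}$ and $r\in G$ such that: (i) $m$ divides $n$, if $n$ is finite (in particular $m$ is then finite); (ii) if $m$ is finite then $c_i-c_{i+m}\in H$ for each $i\in\mathbb{Z}_n$; (iii) if $n$ and $m$ are finite then $\frac nm\cdot r\in H$; (iv) for all $a,a'\in G$ and $i,i'\in\mathbb{Z}_n$, $$(a,i)\asymp(a',i')\iff i-i'\equiv 0\pmod m\ \text{ and }\ \begin{cases}a'-a\equiv\frac{i-i'}{m}\cdot r\pmod H&\text{if } m<\infty,\\ a'-a\in H&\text{if } m=\infty.\end{cases}$$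
   Context: $\mathbb{N}$ denotes the positive integers. $\mathbb{Z}_n=\mathbb{Z}/n\mathbb{Z}$ for finite $n$, and $\mathbb{Z}_\infty=\mathbb{Z}$; $a\equiv b\pmod\infty$ means $a=b$. In (iv), if $n$ is finite, $i,i'$ are represented by integers when forming $\frac{i-i'}{m}$; by (i) and (iii) the condition does not depend on the representatives. A solution (set-theoretic, non-degenerate, involutive solution of the Yang-Baxter equation) is a triple $(X,\sigma,\tau)$ with $X$ a non-empty set and $\sigma,\tau\colon X^2\to X$ such that, writing $\sigma_x=\sigma(x,\cdot)$ and $\tau_y=\tau(\cdot,y)$, the map $r(x,y)=(\sigma_x(y),\tau_y(x))$ is a bijection of $X^2$ satisfying $(\mathrm{id}\times r)(r\times \mathrm{id})(\mathrm{id}\times r)=(r\times \mathrm{id})(\mathrm{id}\times r)(r\times \mathrm{id})$, all $\sigma_x,\tau_y$ are bijections, and $r^2=\mathrm{id}$. $\mathcal{S}(G\times\mathbb{Z}_n,\mathbf{c})$ denotes the solution $(G\times\mathbb{Z}_n,\sigma,\tau)$ with $\sigma_{(a,i)}((b,j))=(b+c_{i-j-1}-c_{-j-1},j+1)$ and $\tau_{(a,i)}((b,j))=(b-c_{i-j+1}+c_{-j},j-1)$. A congruence of a solution $(X,\sigma,\tau)$ is an equivalence relation $\asymp$ on $X$ such that $x_1\asymp x_2$ and $y_1\asymp y_2$ imply $\sigma_{x_1}^{\varepsilon}(y_1)\asymp\sigma_{x_2}^{\varepsilon}(y_2)$ for both $\varepsilon\in\{-1,1\}$. *)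

theory Defs
  imports "HOL-Algebra.Elementary_Groups" "HOL-Number_Theory.Cong" "HOL-Library.Extended_Nat"
begin

definition yb_map :: "('x \<Rightarrow> 'x \<Rightarrow> 'x) \<Rightarrow> ('x \<Rightarrow> 'x \<Rightarrow> 'x) \<Rightarrow> 'x \<times> 'x \<Rightarrow> 'x \<times> 'x"
  where "yb_map \<sigma> \<tau> = (\<lambda>(x, y). (\<sigma> x y, \<tau> x y))"

definition map_left :: "('x \<times> 'x \<Rightarrow> 'x \<times> 'x) \<Rightarrow> 'x \<times> 'x \<times> 'x \<Rightarrow> 'x \<times> 'x \<times> 'x"
  where "map_left r = (\<lambda>(x, y, z). let (u, v) = r (x, y) in (u, v, z))"

definition map_right :: "('x \<times> 'x \<Rightarrow> 'x \<times> 'x) \<Rightarrow> 'x \<times> 'x \<times> 'x \<Rightarrow> 'x \<times> 'x \<times> 'x"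
  where "map_right r = (\<lambda>(x, y, z). (x, r (y, z)))"

text \<open>Both operations are curried in the order in which they take a pair from \<open>X \<times> X\<close>: the
  permutation \<open>\<sigma>\<^sub>x\<close> is \<open>\<sigma> x\<close>, while \<open>\<tau>\<^sub>y\<close> is \<open>\<lambda>x. \<tau> x y\<close>.\<close>

definition yb_solution :: "'x set \<Rightarrow> ('x \<Rightarrow> 'x \<Rightarrow> 'x) \<Rightarrow> ('x \<Rightarrow> 'x \<Rightarrow> 'x) \<Rightarrow> bool"
  where "yb_solution X \<sigma> \<tau> \<longleftrightarrow>
    X \<noteq> {} \<and>
    bij_betw (yb_map \<sigma> \<tau>) (X \<times> X) (X \<times> X) \<and>
    (\<forall>t \<in> X \<times> X \<times> X.
       map_right (yb_map \<sigma> \<tau>) (map_left (yb_map \<sigma> \<tau>) (map_right (yb_map \<sigma> \<tau>) t)) =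
       map_left (yb_map \<sigma> \<tau>) (map_right (yb_map \<sigma> \<tau>) (map_left (yb_map \<sigma> \<tau>) t))) \<and>
    (\<forall>x\<in>X. bij_betw (\<sigma> x) X X) \<and>
    (\<forall>y\<in>X. bij_betw (\<lambda>x. \<tau> x y) X X) \<and>
    (\<forall>p \<in> X \<times> X. yb_map \<sigma> \<tau> (yb_map \<sigma> \<tau> p) = p)"

text \<open>Intended for solutions: then \<open>\<sigma> x\<close> permutes \<open>X\<close> and \<open>inv_into X (\<sigma> x)\<close> is \<open>\<sigma>\<^sub>x\<close> to the
  power \<open>-1\<close>.  The operation \<open>\<tau>\<close> plays no role in the condition.\<close>

definition yb_congruence ::
    "'x set \<Rightarrow> ('x \<Rightarrow> 'x \<Rightarrow> 'x) \<Rightarrow> ('x \<Rightarrow> 'x \<Rightarrow> 'x) \<Rightarrow> ('x \<times> 'x) set \<Rightarrow> bool"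
  where "yb_congruence X \<sigma> \<tau> R \<longleftrightarrow>
    equiv X R \<and>
    (\<forall>x1 x2 y1 y2. (x1, x2) \<in> R \<longrightarrow> (y1, y2) \<in> R \<longrightarrow>
       (\<sigma> x1 y1, \<sigma> x2 y2) \<in> R \<and>
       (inv_into X (\<sigma> x1) y1, inv_into X (\<sigma> x2) y2) \<in> R)"

text \<open>The modulus \<open>\<infinity>\<close> is encoded as \<open>0\<close>.  This agrees with the library conventions:
  \<open>integer_mod_group 0\<close> is the additive group of all integers, \<open>k mod 0 = k\<close>,
  and congruence modulo \<open>0\<close> is equality.\<close>

definition modulus :: "enat \<Rightarrow> nat"
  where "modulus n = (case n of enat k \<Rightarrow> k | \<infinity> \<Rightarrow> 0)"

definition Zmod :: "enat \<Rightarrow> int set"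
  where "Zmod n = carrier (integer_mod_group (modulus n))"

definition residue :: "enat \<Rightarrow> int \<Rightarrow> int"
  where "residue n k = k mod int (modulus n)"

text \<open>The abelian group \<open>G\<close> is written multiplicatively, as usual in HOL-Algebra.\<close>

definition S_sigma :: "('g, 'e) monoid_scheme \<Rightarrow> enat \<Rightarrow> (int \<Rightarrow> 'g) \<Rightarrow>
    'g \<times> int \<Rightarrow> 'g \<times> int \<Rightarrow> 'g \<times> int"
  where "S_sigma G n c = (\<lambda>(a, i) (b, j).
    (b \<otimes>\<^bsub>G\<^esub> c (residue n (i - j - 1)) \<otimes>\<^bsub>G\<^esub> inv\<^bsub>G\<^esub> (c (residue n (- j - 1))), residue n (j + 1)))"

text \<open>In the next definition \<open>(a, i)\<close> is the index of \<open>\<tau>\<^sub>(\<^sub>a\<^sub>,\<^sub>i\<^sub>)\<close> and hence the second argument.\<close>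

definition S_tau :: "('g, 'e) monoid_scheme \<Rightarrow> enat \<Rightarrow> (int \<Rightarrow> 'g) \<Rightarrow>
    'g \<times> int \<Rightarrow> 'g \<times> int \<Rightarrow> 'g \<times> int"
  where "S_tau G n c = (\<lambda>(b, j) (a, i).
    (b \<otimes>\<^bsub>G\<^esub> inv\<^bsub>G\<^esub> (c (residue n (i - j + 1))) \<otimes>\<^bsub>G\<^esub> c (residue n (- j)), residue n (j - 1)))"

definition S_solution :: "('g, 'e) monoid_scheme \<Rightarrow> enat \<Rightarrow> (int \<Rightarrow> 'g) \<Rightarrow>
    ('g \<times> int) set \<times> ('g \<times> int \<Rightarrow> 'g \<times> int \<Rightarrow> 'g \<times> int) \<times> ('g \<times> int \<Rightarrow> 'g \<times> int \<Rightarrow> 'g \<times> int)"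
  where "S_solution G n c = (carrier G \<times> Zmod n, S_sigma G n c, S_tau G n c)"

lemma residue_in_Zmod: "0 < n \<Longrightarrow> residue n k \<in> Zmod n"
  by (cases n) (auto simp: residue_def Zmod_def modulus_def carrier_integer_mod_group zero_enat_def)

lemma residue_id: "k \<in> Zmod n \<Longrightarrow> residue n k = k"
  by (auto simp: residue_def Zmod_def carrier_integer_mod_group split: if_splits)

lemma residue_shift:
  "residue n (residue n k + l) = residue n (k + l)"
  "residue n (l + residue n k) = residue n (l + k)"
  "residue n (residue n k - l) = residue n (k - l)"
  "residue n (l - residue n k) = residue n (l - k)"
  "residue n (l - residue n k + l') = residue n (l - k + l')"
  "residue n (l - residue n k - l') = residue n (l - k - l')"
  "residue n (residue n k - l + l') = residue n (k - l + l')"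
  "residue n (residue n k - l - l') = residue n (k - l - l')"
  "residue n (l - (l' + residue n k)) = residue n (l - (l' + k))"
  "residue n (l + residue n k - l') = residue n (l + k - l')"
  "residue n (- residue n k) = residue n (- k)"
  "residue n (- residue n k - l) = residue n (- k - l)"
proof -
  define M where "M = int (modulus n)"
  obtain q where q: "residue n k = k + M * q"
    by (metis M_def residue_def mod_eqE mod_mod_trivial)
  show "residue n (residue n k + l) = residue n (k + l)"
    "residue n (l + residue n k) = residue n (l + k)"
    "residue n (residue n k - l) = residue n (k - l)"
    "residue n (l - residue n k) = residue n (l - k)"
    "residue n (l - residue n k + l') = residue n (l - k + l')"
    "residue n (l - residue n k - l') = residue n (l - k - l')"
    "residue n (residue n k - l + l') = residue n (k - l + l')"
    "residue n (residue n k - l - l') = residue n (k - l - l')"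
    "residue n (l - (l' + residue n k)) = residue n (l - (l' + k))"
    "residue n (l + residue n k - l') = residue n (l + k - l')"
    "residue n (- residue n k) = residue n (- k)"
    "residue n (- residue n k - l) = residue n (- k - l)"
    unfolding q by (simp_all add: residue_def mod_eq_dvd_iff flip: M_def)
qed

context comm_group
begin

lemma cancel_left:
  "x \<in> carrier G \<Longrightarrow> y \<in> carrier G \<Longrightarrow> x \<otimes> (inv x \<otimes> y) = y"
  "x \<in> carrier G \<Longrightarrow> y \<in> carrier G \<Longrightarrow> inv x \<otimes> (x \<otimes> y) = y"
  by (simp_all add: m_assoc[symmetric])

lemma cancel_left2:
  "x \<in> carrier G \<Longrightarrow> y \<in> carrier G \<Longrightarrow> z \<in> carrier G \<Longrightarrow> x \<otimes> (y \<otimes> (inv x \<otimes> z)) = y \<otimes> z"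
  "x \<in> carrier G \<Longrightarrow> y \<in> carrier G \<Longrightarrow> z \<in> carrier G \<Longrightarrow> inv x \<otimes> (y \<otimes> (x \<otimes> z)) = y \<otimes> z"
  "x \<in> carrier G \<Longrightarrow> y \<in> carrier G \<Longrightarrow> x \<otimes> (y \<otimes> inv x) = y"
  "x \<in> carrier G \<Longrightarrow> y \<in> carrier G \<Longrightarrow> inv x \<otimes> (y \<otimes> x) = y"
  by (metis m_lcomm m_closed inv_closed cancel_left, metis m_lcomm m_closed inv_closed cancel_left,
      metis m_lcomm inv_closed r_inv r_one, metis m_lcomm inv_closed l_inv r_one)

lemma S_solution_is_solution:
  assumes n: "0 < n" and c: "c \<in> Zmod n \<rightarrow> carrier G"
    and S: "(X, \<sigma>, \<tau>) = S_solution G n c"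
  shows "yb_solution X \<sigma> \<tau>"
proof -
  have X: "X = carrier G \<times> Zmod n" and \<sigma>: "\<sigma> = S_sigma G n c" and \<tau>: "\<tau> = S_tau G n c"
    using S by (simp_all add: S_solution_def)
  define d where "d k = c (residue n k)" for k
  have d: "d k \<in> carrier G" for k
    using c residue_in_Zmod[OF n] by (auto simp: d_def)
  have dres: "d (residue n k + l) = d (k + l)" "d (residue n k - l) = d (k - l)"
    "d (l - residue n k) = d (l - k)" "d (l - residue n k + l') = d (l - k + l')"
    "d (l - residue n k - l') = d (l - k - l')" "d (l - (l' + residue n k)) = d (l - (l' + k))"
    "d (l + residue n k - l') = d (l + k - l')"
    "d (- residue n k) = d (- k)"
    "d (- residue n k - l) = d (- k - l)" "d (residue n k - l - l') = d (k - l - l')"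
    "d (residue n k - l + l') = d (k - l + l')" for k l l'
    by (simp_all add: d_def residue_shift)
  have s: "\<sigma> (a, i) (b, j) = (b \<otimes> d (i - j - 1) \<otimes> inv (d (- j - 1)), residue n (j + 1))" for a b i j
    by (simp add: \<sigma> S_sigma_def d_def)
  have t: "\<tau> (b, j) (a, i) = (b \<otimes> inv (d (i - j + 1)) \<otimes> d (- j), residue n (j - 1))" for a b i j
    by (simp add: \<tau> S_tau_def d_def)
  have r: "yb_map \<sigma> \<tau> (x, y) = (\<sigma> x y, \<tau> x y)" for x y
    by (simp add: yb_map_def)
  have sX: "\<sigma> x y \<in> X" and tX: "\<tau> x y \<in> X" if "x \<in> X" "y \<in> X" for x y
    using that d residue_in_Zmod[OF n] by (auto simp: X s t)
  have inv: "yb_map \<sigma> \<tau> (yb_map \<sigma> \<tau> p) = p" if "p \<in> X \<times> X" for p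
    using that d
    by (auto simp: X r s t dres residue_shift residue_id m_assoc algebra_simps cancel_left cancel_left2)
  have braid: "map_right (yb_map \<sigma> \<tau>) (map_left (yb_map \<sigma> \<tau>) (map_right (yb_map \<sigma> \<tau>) u)) =
       map_left (yb_map \<sigma> \<tau>) (map_right (yb_map \<sigma> \<tau>) (map_left (yb_map \<sigma> \<tau>) u))"
    if "u \<in> X \<times> X \<times> X" for u
    using that d
    by (auto simp: X r s t dres residue_shift residue_id map_left_def map_right_def
     m_ac algebra_simps cancel_left cancel_left2 inv_mult)
  have bs: "bij_betw (\<sigma> x) X X" if "x \<in> X" for x
  proof -
    obtain a i where x: "x = (a, i)" by force
    have "bij_betw (\<sigma> (a, i)) X X"
      by (rule bij_betw_byWitness[where f' =
          "\<lambda>(b, j). (b \<otimes> d (- j) \<otimes> inv (d (i - j)), residue n (j - 1))"])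
        (use d residue_in_Zmod[OF n] in
         \<open>auto simp: X s dres residue_shift residue_id m_assoc cancel_left cancel_left2 algebra_simps\<close>)
    then show ?thesis by (simp add: x)
  qed
  have bt: "bij_betw (\<lambda>x. \<tau> x y) X X" if "y \<in> X" for y
  proof -
    obtain a i where y: "y = (a, i)" by force
    have "bij_betw (\<lambda>x. \<tau> x (a, i)) X X"
      by (rule bij_betw_byWitness[where f' =
          "\<lambda>(b, j). (b \<otimes> inv (d (- j - 1)) \<otimes> d (i - j), residue n (j + 1))"])
        (use d residue_in_Zmod[OF n] in
         \<open>auto simp: X t dres residue_shift residue_id m_assoc cancel_left cancel_left2 algebra_simps\<close>)
    then show ?thesis by (simp add: y)
  qed
  have "bij_betw (yb_map \<sigma> \<tau>) (X \<times> X) (X \<times> X)"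
    by (rule bij_betw_byWitness[where f' = "yb_map \<sigma> \<tau>"]) (use inv sX tX in \<open>auto simp: r\<close>)
  moreover have "X \<noteq> {}"
    using residue_in_Zmod[OF n] by (auto simp: X)
  ultimately show ?thesis
    using inv braid bs bt unfolding yb_solution_def by blast
qed

end

end

theory Submission
  imports Defs
begin

text \<open>
  Lift an equivalence relation on \<open>G \<times> \<int>\<^sub>n\<close> to \<open>G \<times> \<int>\<close>
  along the residue map. Letting \<open>\<sigma>\<^sub>x\<close> and its inverse act with \<open>x\<close> in
  the fibre over \<open>0\<close> shows that a lifted congruence is invariant under shifts of the second
  coordinate. Hence, if \<open>y\<^sub>1 \<asymp> y\<^sub>2\<close>, then \<open>\<sigma>\<^sub>x\<close> may
  be applied to \<open>y\<^sub>1\<close> and \<open>y\<^sub>2\<close> with \<open>x\<close> a shift of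
  \<open>y\<^sub>1\<close> and of \<open>y\<^sub>2\<close> respectively. Doing so, and then the same with
  \<open>\<sigma>\<^sub>x\<^sup>-\<^sup>1\<close>, translates both first coordinates by the same
  \<open>c\<^sub>k\<close>. As the \<open>c\<^sub>k\<close> generate \<open>G\<close>, a lifted congruence is
  the coset relation of a subgroup \<open>K\<close> of \<open>G \<times> \<int>\<close>. The data
  \<open>H\<close>, \<open>m\<close> and \<open>r\<close> describe \<open>K\<close>: \<open>H = K \<inter>
  G\<close>, \<open>m\<close> generates the projection of \<open>K\<close> to \<open>\<int>\<close>, and
  \<open>(-r, m) \<in> K\<close>. With \<open>\<infinity>\<close> encoded as modulus \<open>0\<close>, the
  case \<open>m = \<infinity>\<close> needs no separate treatment, because \<open>k div 0 = 0\<close>.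
\<close>

section \<open>Subgroups of the integers, and membership in a subgroup\<close>

lemma int_subgroup_multiples:
  fixes S :: "int set"
  assumes zero: "0 \<in> S" and diff: "\<And>x y. x \<in> S \<Longrightarrow> y \<in> S \<Longrightarrow> x - y \<in> S"
  obtains M :: nat where "\<And>k. k \<in> S \<longleftrightarrow> int M dvd k"
proof (cases "\<exists>m. 0 < m \<and> int m \<in> S")
  case True
  define M where "M = (LEAST m. 0 < m \<and> int m \<in> S)"
  have M: "0 < M" "int M \<in> S"
    using LeastI_ex[OF True] by (simp_all add: M_def)
  have least: "M \<le> m" if "0 < m" "int m \<in> S" for m
    using that by (simp add: M_def Least_le)
  have minus: "- x \<in> S" if "x \<in> S" for x
    using diff[OF zero that] by simp
  have add: "x + y \<in> S" if "x \<in> S" "y \<in> S" for x y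
    using diff[OF that(1) minus[OF that(2)]] by simp
  have mult: "int M * q \<in> S" for q
  proof (induction q rule: int_induct[where k = 0])
    case (step1 i)
    then show ?case using add[OF _ M(2)] by (simp add: distrib_left)
  next
    case (step2 i)
    then show ?case using diff[OF _ M(2)] by (simp add: right_diff_distrib)
  qed (simp add: zero)
  have "int M dvd k" if "k \<in> S" for k
  proof -
    have "k mod int M \<in> S"
      using diff[OF that mult[of "k div int M"]] by (simp add: minus_mult_div_eq_mod)
    then have "\<not> 0 < k mod int M"
      using least[of "nat (k mod int M)"] M(1) pos_mod_bound[of "int M" k]
      by (smt (verit) int_nat_eq of_nat_0_less_iff of_nat_le_iff)
    moreover have "0 \<le> k mod int M"
      using M(1) by simp
    ultimately have "k mod int M = 0"
      by linarith
    then show ?thesis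
      by (rule mod_0_imp_dvd)
  qed
  then show ?thesis
    using mult by (intro that[of M]) auto
next
  case False
  have "x = 0" if "x \<in> S" for x
  proof (rule ccontr)
    assume "x \<noteq> 0"
    moreover have "- x \<in> S"
      using diff[OF zero that] by simp
    ultimately have "0 < nat \<bar>x\<bar> \<and> int (nat \<bar>x\<bar>) \<in> S"
      using that by (auto simp: abs_if)
    then show False using False by blast
  qed
  \<comment> \<open>The trivial subgroup is described by the generator \<open>0\<close>, which later
    encodes the modulus at infinity.\<close>
  then show ?thesis
    using zero by (intro that[of 0]) auto
qed

lemma (in group) subgroup_mult_right_iff:
  assumes "subgroup H G" "x \<in> carrier G" "h \<in> H"
  shows "x \<otimes> h \<in> H \<longleftrightarrow> x \<in> H"
proof
  interpret subgroup H G by fact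
  assume "x \<otimes> h \<in> H"
  then have "x \<otimes> h \<otimes> inv h \<in> H"
    using assms(3) by blast
  then show "x \<in> H"
    using assms(2,3) subset by (simp add: m_assoc subsetD)
qed (use assms in \<open>simp add: subgroup.m_closed\<close>)

lemma (in group) subgroup_inv_iff:
  assumes "subgroup H G" "x \<in> carrier G"
  shows "inv x \<in> H \<longleftrightarrow> x \<in> H"
  using assms subgroup.m_inv_closed[OF assms(1), of "inv x"] subgroup.m_inv_closed[OF assms(1), of x]
  by auto

lemma residue_dvd: "int (modulus n) dvd residue n k - k"
  by (simp add: residue_def mod_eq_dvd_iff[symmetric])

section \<open>The solution in terms of integer indices\<close>

locale cyclic_data = comm_group G for G (structure) +
  fixes n :: enat and c :: "int \<Rightarrow> 'a"
  assumes n_pos: "0 < n" and c_closed: "c \<in> Zmod n \<rightarrow> carrier G"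
begin

abbreviation X where "X \<equiv> carrier G \<times> Zmod n"

text \<open>The periodic extension of \<open>c\<close> to all integers, so that index arithmetic
  takes place in the integers without reductions.\<close>

definition d :: "int \<Rightarrow> 'a" where "d k = c (residue n k)"

lemma d_closed [simp]: "d k \<in> carrier G"
  using c_closed residue_in_Zmod[OF n_pos] by (auto simp: d_def)

lemma residue_closed [simp]: "residue n k \<in> Zmod n"
  using residue_in_Zmod[OF n_pos] .

lemma S_sigma_residue:
  "S_sigma G n c (a, residue n i) (b, residue n j) =
    (b \<otimes> d (i - j - 1) \<otimes> inv (d (- j - 1)), residue n (j + 1))"
proof -
  have "residue n (residue n i - residue n j - 1) = residue n (i - j - 1)"
    by (simp only: residue_shift(6)) (simp only: residue_shift(8))
  then show ?thesis
    by (simp add: S_sigma_def d_def residue_shift)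
qed

lemma bij_S_sigma: "x \<in> X \<Longrightarrow> bij_betw (S_sigma G n c x) X X"
  using S_solution_is_solution[OF n_pos c_closed, of X "S_sigma G n c" "S_tau G n c"]
  unfolding S_solution_def yb_solution_def by blast

text \<open>At index \<open>j - 1\<close> the permutation contributes \<open>d (i - j)\<close> and
  \<open>inv (d (- j))\<close>, exactly the factors that the right-hand side cancels. Injectivity
  makes this preimage the value of \<open>inv_into\<close>.\<close>

lemma inv_S_sigma_residue:
  assumes "a \<in> carrier G" "b \<in> carrier G"
  shows "inv_into X (S_sigma G n c (a, residue n i)) (b, residue n j) =
    (b \<otimes> d (- j) \<otimes> inv (d (i - j)), residue n (j - 1))"
proof (rule inv_into_f_eq)
  show "inj_on (S_sigma G n c (a, residue n i)) X"
    using bij_S_sigma[of "(a, residue n i)"] assms by (simp add: bij_betw_def)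
  show "S_sigma G n c (a, residue n i) (b \<otimes> d (- j) \<otimes> inv (d (i - j)), residue n (j - 1)) =
      (b, residue n j)"
    using assms by (simp add: S_sigma_residue m_ac cancel_left cancel_left2)
qed (use assms in simp)

end

section \<open>Lifted equivalence relations; coset relations are congruences\<close>

locale cyclic_relation = cyclic_data +
  fixes R :: "(('a \<times> int) \<times> ('a \<times> int)) set"
  assumes equiv_R: "equiv X R"
begin

definition rel :: "'a \<Rightarrow> int \<Rightarrow> 'a \<Rightarrow> int \<Rightarrow> bool"
  where "rel a i b j \<longleftrightarrow> ((a, residue n i), (b, residue n j)) \<in> R"

lemma rel_closed: "rel a i b j \<Longrightarrow> a \<in> carrier G \<and> b \<in> carrier G"
  using equiv_R by (auto simp: rel_def equiv_def)

lemma rel_refl: "a \<in> carrier G \<Longrightarrow> rel a i a i"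
  using equiv_R by (auto simp: rel_def equiv_def refl_on_def)

lemma rel_sym: "rel a i b j \<Longrightarrow> rel b j a i"
  using equiv_R by (auto simp: rel_def equiv_def dest: symD)

lemma rel_trans: "rel a i b j \<Longrightarrow> rel b j e k \<Longrightarrow> rel a i e k"
  using equiv_R by (auto simp: rel_def equiv_def dest: transD)

text \<open>The trace of the residue map on the lifted relation. It is the source of conditions (i)
  and (iii); for infinite \<open>n\<close> it is mere reflexivity.\<close>

lemma rel_modulus: "a \<in> carrier G \<Longrightarrow> rel a i a (i + int (modulus n))"
  using rel_refl[of a i] by (simp add: rel_def residue_def)

lemma R_cases:
  assumes "(x, y) \<in> R"
  obtains a i b j where "x = (a, residue n i)" "y = (b, residue n j)" "rel a i b j"
proof -
  obtain a i b j where xy: "x = (a, i)" "y = (b, j)"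
    by fastforce
  then have "i \<in> Zmod n" "j \<in> Zmod n"
    using assms equiv_R by (auto simp: equiv_def)
  then show ?thesis
    using that[of a i b j] xy assms by (simp add: rel_def residue_id)
qed

text \<open>Every element of \<open>X\<close> is its own representative, so the congruence property
  may be tested on integer indices, where both permutations have explicit formulas.\<close>

lemma yb_congruence_iff_rel:
  "yb_congruence X (S_sigma G n c) \<tau> R \<longleftrightarrow>
    (\<forall>a i a' i' b j b' j'. rel a i a' i' \<longrightarrow> rel b j b' j' \<longrightarrow>
      rel (b \<otimes> d (i - j - 1) \<otimes> inv (d (- j - 1))) (j + 1)
        (b' \<otimes> d (i' - j' - 1) \<otimes> inv (d (- j' - 1))) (j' + 1) \<and>
      rel (b \<otimes> d (- j) \<otimes> inv (d (i - j))) (j - 1)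
        (b' \<otimes> d (- j') \<otimes> inv (d (i' - j'))) (j' - 1))"
  (is "?L \<longleftrightarrow> ?R")
proof
  assume L: ?L
  show ?R
  proof (intro allI impI)
    fix a i a' i' b j b' j'
    assume x: "rel a i a' i'" and y: "rel b j b' j'"
    have "(S_sigma G n c (a, residue n i) (b, residue n j),
          S_sigma G n c (a', residue n i') (b', residue n j')) \<in> R \<and>
        (inv_into X (S_sigma G n c (a, residue n i)) (b, residue n j),
          inv_into X (S_sigma G n c (a', residue n i')) (b', residue n j')) \<in> R"
      using L x y unfolding yb_congruence_def rel_def by blast
    then show "rel (b \<otimes> d (i - j - 1) \<otimes> inv (d (- j - 1))) (j + 1)
        (b' \<otimes> d (i' - j' - 1) \<otimes> inv (d (- j' - 1))) (j' + 1) \<and>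
      rel (b \<otimes> d (- j) \<otimes> inv (d (i - j))) (j - 1)
        (b' \<otimes> d (- j') \<otimes> inv (d (i' - j'))) (j' - 1)"
      using rel_closed[OF x] rel_closed[OF y]
      by (simp add: S_sigma_residue inv_S_sigma_residue rel_def)
  qed
next
  assume R: ?R
  show ?L
    unfolding yb_congruence_def
  proof (intro conjI allI impI equiv_R)
    fix x1 x2 y1 y2
    assume xR: "(x1, x2) \<in> R" and yR: "(y1, y2) \<in> R"
    obtain a i a' i' where x_eq: "x1 = (a, residue n i)" "x2 = (a', residue n i')"
      and x: "rel a i a' i'"
      by (rule R_cases[OF xR])
    obtain b j b' j' where y_eq: "y1 = (b, residue n j)" "y2 = (b', residue n j')"
      and y: "rel b j b' j'"
      by (rule R_cases[OF yR])
    show "(S_sigma G n c x1 y1, S_sigma G n c x2 y2) \<in> R"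
      and "(inv_into X (S_sigma G n c x1) y1, inv_into X (S_sigma G n c x2) y2) \<in> R"
      using R x y rel_closed[OF x] rel_closed[OF y]
      by (simp_all add: x_eq y_eq S_sigma_residue inv_S_sigma_residue flip: rel_def)
  qed
qed

text \<open>Independence of representatives: reducing the indices changes \<open>i - j\<close> by a
  multiple of \<open>modulus n\<close>, hence the exponent of \<open>r\<close> by a multiple of
  \<open>modulus n div M\<close>, and \<open>rH\<close> absorbs the resulting power. For infinite
  \<open>n\<close> the change is zero.\<close>

lemma rel_iff_of_representatives:
  assumes H: "subgroup H G" and r: "r \<in> carrier G"
    and dvd: "int M dvd int (modulus n)" and rH: "r [^] (modulus n div M) \<in> H"
    and rel: "\<And>a b i j. \<lbrakk>a \<in> carrier G; b \<in> carrier G; i \<in> Zmod n; j \<in> Zmod n\<rbrakk> \<Longrightarrow>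
      ((a, i), (b, j)) \<in> R \<longleftrightarrow>
        int M dvd i - j \<and> a \<otimes> inv b \<otimes> r [^] ((i - j) div int M) \<in> H"
    and ab: "a \<in> carrier G" "b \<in> carrier G"
  shows "rel a i b j \<longleftrightarrow> int M dvd i - j \<and> a \<otimes> inv b \<otimes> r [^] ((i - j) div int M) \<in> H"
proof -
  define N where "N = int (modulus n)"
  obtain p where "residue n i - i = N * p"
    using residue_dvd[of n i] by (auto simp: N_def)
  moreover obtain q where "residue n j - j = N * q"
    using residue_dvd[of n j] by (auto simp: N_def)
  ultimately have eq: "residue n i - residue n j = (i - j) + N * (p - q)"
    by (simp add: algebra_simps)
  have dvd_iff: "int M dvd residue n i - residue n j \<longleftrightarrow> int M dvd i - j"
    unfolding eq using dvd by (simp add: N_def dvd_add_left_iff)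
  have "r [^] (N div int M) \<in> H"
    using rH by (simp add: N_def int_pow_int flip: zdiv_int)
  then have powH: "r [^] ((N div int M) * (p - q)) \<in> H"
    using subgroup_int_pow_closed[OF H, of "r [^] (N div int M)" "p - q"] r
    by (simp add: int_pow_pow)
  have "a \<otimes> inv b \<otimes> r [^] ((residue n i - residue n j) div int M) \<in> H \<longleftrightarrow>
      a \<otimes> inv b \<otimes> r [^] ((i - j) div int M) \<in> H" if "int M dvd i - j"
  proof -
    have "(residue n i - residue n j) div int M = (i - j) div int M + N * (p - q) div int M"
      using that by (simp only: eq div_plus_div_distrib_dvd_left)
    also have "N * (p - q) div int M = (N div int M) * (p - q)"
      using dvd by (simp add: N_def dvd_div_mult)
    finally have "a \<otimes> inv b \<otimes> r [^] ((residue n i - residue n j) div int M) =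
        a \<otimes> inv b \<otimes> r [^] ((i - j) div int M) \<otimes> r [^] ((N div int M) * (p - q))"
      using ab r by (simp add: int_pow_mult m_assoc)
    then show ?thesis
      using subgroup_mult_right_iff[OF H _ powH] ab r by simp
  qed
  then show ?thesis
    using rel[OF ab, of "residue n i" "residue n j"] dvd_iff by (auto simp: rel_def)
qed

text \<open>Both permutations multiply by a quotient of values of \<open>d\<close> that depends on
  the indices only, and move the index by a constant. Related arguments change the indices by
  multiples of \<open>M\<close>, so by \<open>dH\<close> the quotients differ by elements of
  \<open>H\<close>.\<close>

lemma congruence_of_coset_relation:
  assumes H: "subgroup H G" and r: "r \<in> carrier G"
    and dH: "\<And>i j. int M dvd i - j \<Longrightarrow> d i \<otimes> inv (d j) \<in> H"
    and rel: "\<And>a b i j. \<lbrakk>a \<in> carrier G; b \<in> carrier G\<rbrakk> \<Longrightarrow>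
      rel a i b j \<longleftrightarrow> int M dvd i - j \<and> a \<otimes> inv b \<otimes> r [^] ((i - j) div int M) \<in> H"
  shows "yb_congruence X (S_sigma G n c) \<tau> R"
proof -
  interpret H: subgroup H G by (rule H)
  \<comment> \<open>Treats a permutation and its inverse at once: they are the cases
    \<open>k = 1\<close> and \<open>k = - 1\<close>.\<close>
  have step: "rel (b \<otimes> d u \<otimes> inv (d v)) (j + k) (b' \<otimes> d u' \<otimes> inv (d v')) (j' + k)"
    if y: "rel b j b' j'" and u: "int M dvd u - u'" and v: "int M dvd v - v'"
    for b b' j j' k u u' v v'
  proof -
    let ?q = "r [^] ((j - j') div int M)"
    have b: "b \<in> carrier G" "b' \<in> carrier G"
      using rel_closed[OF y] by auto
    have "(b \<otimes> inv b' \<otimes> ?q) \<otimes> (d u \<otimes> inv (d u')) \<otimes> inv (d v \<otimes> inv (d v')) \<in> H"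
      using y b dH[OF u] dH[OF v] by (simp add: rel)
    also have "(b \<otimes> inv b' \<otimes> ?q) \<otimes> (d u \<otimes> inv (d u')) \<otimes> inv (d v \<otimes> inv (d v')) =
        (b \<otimes> d u \<otimes> inv (d v)) \<otimes> inv (b' \<otimes> d u' \<otimes> inv (d v')) \<otimes> ?q"
      using b r by (simp add: inv_mult m_ac)
    finally show ?thesis
      using y b by (simp add: rel)
  qed
  show ?thesis
    unfolding yb_congruence_iff_rel
  proof (intro allI impI)
    fix a i a' i' b j b' j'
    assume x: "rel a i a' i'" and y: "rel b j b' j'"
    have dvd: "int M dvd i - i'" "int M dvd j - j'"
      using x y rel_closed[OF x] rel_closed[OF y] by (auto simp: rel)
    have "int M dvd (i - i') - (j - j')" "int M dvd - (j - j')"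
      using dvd by (blast intro: dvd_diff, simp only: dvd_minus_iff)
    then show "rel (b \<otimes> d (i - j - 1) \<otimes> inv (d (- j - 1))) (j + 1)
        (b' \<otimes> d (i' - j' - 1) \<otimes> inv (d (- j' - 1))) (j' + 1) \<and>
      rel (b \<otimes> d (- j) \<otimes> inv (d (i - j))) (j - 1)
        (b' \<otimes> d (- j') \<otimes> inv (d (i' - j'))) (j' - 1)"
      using step[OF y, of "i - j - 1" "i' - j' - 1" "- j - 1" "- j' - 1" 1]
        step[OF y, of "- j" "- j'" "i - j" "i' - j'" "- 1"]
      by (simp add: algebra_simps)
  qed
qed

end

section \<open>Congruences are coset relations\<close>

locale cyclic_congruence = cyclic_relation +
  assumes cong: "yb_congruence X (S_sigma G n c) (S_tau G n c) R"
    and c_zero: "c 0 = \<one>"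
    and c_generate: "generate G (c ` Zmod n) = carrier G"
begin

lemma d_zero [simp]: "d 0 = \<one>"
  by (simp add: d_def residue_def c_zero)

lemma rel_sigma:
  assumes "rel a i a' i'" "rel b j b' j'"
  shows "rel (b \<otimes> d (i - j - 1) \<otimes> inv (d (- j - 1))) (j + 1)
    (b' \<otimes> d (i' - j' - 1) \<otimes> inv (d (- j' - 1))) (j' + 1)"
  using cong assms unfolding yb_congruence_iff_rel by blast

lemma rel_sigma_inv:
  assumes "rel a i a' i'" "rel b j b' j'"
  shows "rel (b \<otimes> d (- j) \<otimes> inv (d (i - j))) (j - 1)
    (b' \<otimes> d (- j') \<otimes> inv (d (i' - j'))) (j' - 1)"
  using cong assms unfolding yb_congruence_iff_rel by blast

text \<open>For an acting element with index \<open>0\<close> the two values of \<open>d\<close>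
  coincide and cancel, so \<open>(\<one>, 0)\<close> and its inverse action shift the index by
  \<open>1\<close> and \<open>- 1\<close>.\<close>

lemma rel_shift: "rel a i b j \<Longrightarrow> rel a (i + k) b (j + k)"
proof (induction k rule: int_induct[where k = 0])
  case (step1 k)
  then have "rel a (i + k) b (j + k)" by simp
  from rel_sigma[OF rel_refl[of \<one> 0] this] rel_closed[OF this] show ?case
    by (simp add: m_assoc algebra_simps)
next
  case (step2 k)
  then have "rel a (i + k) b (j + k)" by simp
  from rel_sigma_inv[OF rel_refl[of \<one> 0] this] rel_closed[OF this] show ?case
    by (simp add: m_assoc algebra_simps)
qed simp

lemma rel_translate_d:
  assumes "rel a i b j"
  shows "rel (d k \<otimes> a) i (d k \<otimes> b) j"
proof -
  have ab: "a \<in> carrier G" "b \<in> carrier G"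
    using rel_closed[OF assms] by auto
  \<comment> \<open>The acting elements are the given points shifted by \<open>k + 1\<close>, so the
    index difference gives the same value \<open>d k\<close> on both sides.\<close>
  have "rel (a \<otimes> d k \<otimes> inv (d (- i - 1))) (i + 1) (b \<otimes> d k \<otimes> inv (d (- j - 1))) (j + 1)"
    using rel_sigma[OF rel_shift[OF assms, of "k + 1"] assms] by (simp add: algebra_simps)
  \<comment> \<open>The remaining factors depend on \<open>i\<close> and \<open>j\<close>. Acting
    elements whose indices equal the present ones, \<open>i + 1\<close> and \<open>j + 1\<close>,
    cancel them, because \<open>d 0\<close> is trivial.\<close>
  from rel_sigma_inv[OF rel_shift[OF assms, of 1] this] have "rel (a \<otimes> d k) i (b \<otimes> d k) j"
    using ab by (simp add: m_assoc)
  then show ?thesis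
    using ab by (simp add: m_comm)
qed

lemma rel_translate_inv_d:
  assumes "rel a i b j"
  shows "rel (inv (d k) \<otimes> a) i (inv (d k) \<otimes> b) j"
proof -
  have ab: "a \<in> carrier G" "b \<in> carrier G"
    using rel_closed[OF assms] by auto
  have "rel (a \<otimes> d (- i) \<otimes> inv (d k)) (i - 1) (b \<otimes> d (- j) \<otimes> inv (d k)) (j - 1)"
    using rel_sigma_inv[OF rel_shift[OF assms, of k] assms] by (simp add: algebra_simps)
  \<comment> \<open>Here the acting indices exceed the present ones by \<open>1\<close>, so the
    first factor is \<open>d 0\<close>, and the second removes \<open>d (- i)\<close> and
    \<open>d (- j)\<close>.\<close>
  from rel_sigma[OF assms this] have "rel (a \<otimes> inv (d k)) i (b \<otimes> inv (d k)) j"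
    using ab by (simp add: m_assoc cancel_left2)
  then show ?thesis
    using ab by (simp add: m_comm)
qed

lemma rel_translate:
  assumes "g \<in> carrier G" "rel a i b j"
  shows "rel (g \<otimes> a) i (g \<otimes> b) j"
proof -
  have c: "\<exists>k. h = d k" if "h \<in> c ` Zmod n" for h
    using that by (metis d_def imageE residue_id)
  have "g \<in> generate G (c ` Zmod n)"
    using assms(1) c_generate by simp
  then show ?thesis
    using assms(2)
  \<comment> \<open>The points vary in the induction, as a product acts by translating an already
    translated pair.\<close>
  proof (induction g arbitrary: a i b j rule: generate.induct)
    case one
    then show ?case using rel_closed[OF one] by simp
  next
    case (incl h)
    then show ?case using c[of h] rel_translate_d by auto
  next
    case (inv h)
    then show ?case using c[of h] rel_translate_inv_d by auto
  next
    case (eng g h)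
    have "rel (g \<otimes> (h \<otimes> a)) i (g \<otimes> (h \<otimes> b)) j"
      by (intro eng.IH eng.prems)
    then show ?case
      using eng.hyps rel_closed[OF eng.prems] c_generate by (simp add: m_assoc)
  qed
qed

text \<open>By invariance under translations and shifts, the class of \<open>(\<one>, 0)\<close>
  determines the relation. This class is the subgroup \<open>K\<close> of the outline; the next
  lemmas give its closure under products, inverses and powers.\<close>

lemma rel_iff_base:
  assumes ab: "a \<in> carrier G" "b \<in> carrier G"
  shows "rel a i b j \<longleftrightarrow> rel \<one> 0 (inv a \<otimes> b) (j - i)"
proof
  assume "rel a i b j"
  from rel_shift[OF rel_translate[OF _ this, of "inv a"], of "- i"]
  show "rel \<one> 0 (inv a \<otimes> b) (j - i)"
    using ab by simp
next
  assume "rel \<one> 0 (inv a \<otimes> b) (j - i)"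
  from rel_shift[OF rel_translate[OF ab(1) this], of i] show "rel a i b j"
    using ab by (simp add: cancel_left)
qed

text \<open>The second relation, translated by \<open>g\<close> and shifted by \<open>k\<close>,
  continues the first one.\<close>

lemma base_mult:
  assumes "rel \<one> 0 g k" "rel \<one> 0 h l"
  shows "rel \<one> 0 (g \<otimes> h) (k + l)"
  using rel_trans[OF assms(1)] rel_shift[OF rel_translate[of g, OF _ assms(2)], of k]
    rel_closed[OF assms(1)] by (simp add: add.commute)

lemma base_inv:
  assumes "rel \<one> 0 g k"
  shows "rel \<one> 0 (inv g) (- k)"
  using rel_sym[OF assms] rel_closed[OF assms] by (simp add: rel_iff_base[of g])

lemma base_int_pow:
  assumes "rel \<one> 0 g k"
  shows "rel \<one> 0 (g [^] q) (k * q)"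
proof (induction q rule: int_induct[where k = 0])
  case base
  then show ?case by (simp add: rel_refl)
next
  case (step1 q)
  from base_mult[OF this(2) assms] show ?case
    using rel_closed[OF assms] by (simp add: int_pow_mult m_comm algebra_simps)
next
  case (step2 q)
  from base_mult[OF this(2) base_inv[OF assms]] show ?case
    using rel_closed[OF assms] by (simp add: int_pow_diff algebra_simps)
qed

definition H where "H = {g. rel \<one> 0 g 0}"

lemma subgroup_H: "subgroup H G"
proof
  show "H \<subseteq> carrier G"
    using rel_closed by (auto simp: H_def)
  show "x \<otimes> y \<in> H" if "x \<in> H" "y \<in> H" for x y
    using that base_mult[of x 0 y 0] by (simp add: H_def)
  show "\<one> \<in> H"
    by (simp add: H_def rel_refl)
  show "inv x \<in> H" if "x \<in> H" for x
    using that base_inv[of x 0] by (simp add: H_def)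
qed

lemma d_diff_in_H:
  assumes "rel a i b j"
  shows "d i \<otimes> inv (d j) \<in> H"
  \<comment> \<open>Acting on \<open>(\<one>, - 1)\<close> makes the second factor
    \<open>d 0\<close> and the first one \<open>d j\<close> or \<open>d i\<close>, both over index
    \<open>0\<close>.\<close>
  using rel_sigma[OF rel_sym[OF assms] rel_refl[of \<one> "- 1"]]
  by (simp add: rel_iff_base[of "d j"] H_def m_comm)

text \<open>\<open>S\<close> is the projection of \<open>K\<close> to the integers, \<open>M\<close>
  its generator and \<open>s\<close> an element over \<open>M\<close>. Multiplying by a power of
  \<open>s\<close> moves an element of \<open>K\<close> to index \<open>0\<close>, where membership
  is decided by \<open>H\<close>. The inverse of \<open>s\<close> appears since the quotient of the
  first coordinates is taken in the opposite order.\<close>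

lemma coset_description:
  obtains s M where "s \<in> carrier G" "rel \<one> 0 s (int M)"
    "\<forall>a\<in>carrier G. \<forall>b\<in>carrier G. \<forall>i j. rel a i b j \<longleftrightarrow>
      int M dvd i - j \<and> a \<otimes> inv b \<otimes> inv s [^] ((i - j) div int M) \<in> H"
proof -
  define S where "S = {k. \<exists>g. rel \<one> 0 g k}"
  obtain M where M: "\<And>k. k \<in> S \<longleftrightarrow> int M dvd k"
  proof (rule int_subgroup_multiples[of S])
    show "0 \<in> S"
      using rel_refl[of \<one> 0] by (auto simp: S_def)
    show "x - y \<in> S" if xy: "x \<in> S" "y \<in> S" for x y
    proof -
      obtain g h where "rel \<one> 0 g x" "rel \<one> 0 h y"
        using xy by (auto simp: S_def)
      from base_mult[OF this(1) base_inv[OF this(2)]] show ?thesis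
        by (auto simp: S_def)
    qed
  qed blast
  have "int M \<in> S"
    using M[of "int M"] by simp
  then obtain s where s: "rel \<one> 0 s (int M)"
    by (auto simp: S_def)
  have sG: "s \<in> carrier G"
    using rel_closed[OF s] by simp
  have "rel a i b j \<longleftrightarrow> int M dvd i - j \<and> a \<otimes> inv b \<otimes> inv s [^] ((i - j) div int M) \<in> H"
    if ab: "a \<in> carrier G" "b \<in> carrier G" for a b i j
  proof (cases "int M dvd i - j")
    case False
    then have "\<not> rel \<one> 0 (inv a \<otimes> b) (j - i)"
      using M[of "j - i"] dvd_diff_commute[of "int M" i j] by (auto simp: S_def)
    then show ?thesis
      using False by (simp add: rel_iff_base[OF ab])
  next
    case True
    \<comment> \<open>If \<open>M = 0\<close>, then \<open>i = j\<close> and \<open>q = 0\<close>,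
      so the argument remains valid.\<close>
    define q where "q = (i - j) div int M"
    have Mq: "int M * q = i - j"
      using True by (simp add: q_def)
    have pow: "rel \<one> 0 (s [^] q) (i - j)"
      using base_int_pow[OF s, of q] by (simp add: Mq)
    have eq: "inv (a \<otimes> inv b \<otimes> inv s [^] q) = inv a \<otimes> b \<otimes> s [^] q"
      using ab sG by (simp add: inv_mult int_pow_inv)
    have "rel \<one> 0 (inv a \<otimes> b) (j - i) \<longleftrightarrow> rel \<one> 0 (inv a \<otimes> b \<otimes> s [^] q) 0"
    proof
      show "rel \<one> 0 (inv a \<otimes> b \<otimes> s [^] q) 0" if "rel \<one> 0 (inv a \<otimes> b) (j - i)"
        using base_mult[OF that pow] by simp
      show "rel \<one> 0 (inv a \<otimes> b) (j - i)" if "rel \<one> 0 (inv a \<otimes> b \<otimes> s [^] q) 0"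
        using base_mult[OF that base_inv[OF pow]] ab sG by (simp add: m_assoc)
    qed
    also have "\<dots> \<longleftrightarrow> inv (a \<otimes> inv b \<otimes> inv s [^] q) \<in> H"
      by (simp only: eq H_def mem_Collect_eq)
    also have "\<dots> \<longleftrightarrow> a \<otimes> inv b \<otimes> inv s [^] q \<in> H"
      using ab sG by (intro subgroup_inv_iff[OF subgroup_H]) simp
    finally show ?thesis
      using True by (simp add: rel_iff_base[OF ab] q_def)
  qed
  then show ?thesis
    by (intro that[OF sG s]) blast
qed

end

section \<open>Condition (iv) in uniform form, and the theorem\<close>

lemma (in comm_group) coset_condition_iff:
  assumes H: "subgroup H G" and closed: "r \<in> carrier G" "a \<in> carrier G" "a' \<in> carrier G"
  shows "[x = 0] (mod int (modulus m)) \<and>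
      (case m of
         enat l \<Rightarrow> (a' \<otimes> inv a, r [^] (x div int l)) \<in> rcong H
       | \<infinity> \<Rightarrow> a' \<otimes> inv a \<in> H) \<longleftrightarrow>
    int (modulus m) dvd x \<and> a \<otimes> inv a' \<otimes> r [^] (x div int (modulus m)) \<in> H"
proof -
  have inv: "inv (a' \<otimes> inv a) = a \<otimes> inv a'" "inv (a \<otimes> inv a') = a' \<otimes> inv a"
    using closed by (simp_all add: inv_mult m_comm)
  have "a' \<otimes> inv a \<in> H \<longleftrightarrow> a \<otimes> inv a' \<in> H"
    using subgroup_inv_iff[OF H, of "a' \<otimes> inv a"] closed by (simp add: inv)
  \<comment> \<open>\<open>rcong H\<close> relates \<open>x\<close> to \<open>y\<close> if
    \<open>inv x \<otimes> y\<close> lies in \<open>H\<close>, which reverses the quotient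
    \<open>a' \<otimes> inv a\<close>. In the infinite case division by \<open>0\<close> makes the
    power of \<open>r\<close> trivial, so only this reversal remains.\<close>
  then show ?thesis
    using closed by (cases m) (simp_all add: cong_0_iff modulus_def r_congruent_def inv)
qed

theorem proposition5p8:
  fixes G :: "('g, 'e) monoid_scheme" (structure)
    and n :: enat
    and c :: "int \<Rightarrow> 'g"
    and X :: "('g \<times> int) set"
    and \<sigma> \<tau> :: "'g \<times> int \<Rightarrow> 'g \<times> int \<Rightarrow> 'g \<times> int"
    and R :: "(('g \<times> int) \<times> ('g \<times> int)) set"
  assumes "0 < n"
    and "comm_group G"
    and "c \<in> Zmod n \<rightarrow> carrier G"
    and "c 0 = \<one>"
    and "generate G (c ` Zmod n) = carrier G"
    and "(X, \<sigma>, \<tau>) = S_solution G n c"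
    and "equiv X R"
  shows "yb_congruence X \<sigma> \<tau> R \<longleftrightarrow>
    (\<exists>(H :: 'g set) (m :: enat) (r :: 'g).
       subgroup H G \<and> 0 < m \<and> r \<in> carrier G \<and>
       (\<forall>k. n = enat k \<longrightarrow> (\<exists>l. m = enat l \<and> l dvd k)) \<and>
       (\<forall>l. m = enat l \<longrightarrow> (\<forall>i\<in>Zmod n. c i \<otimes> inv (c (residue n (i + int l))) \<in> H)) \<and>
       (\<forall>k l. n = enat k \<longrightarrow> m = enat l \<longrightarrow> r [^] (k div l) \<in> H) \<and>
       (\<forall>a\<in>carrier G. \<forall>a'\<in>carrier G. \<forall>i\<in>Zmod n. \<forall>i'\<in>Zmod n.
          ((a, i), (a', i')) \<in> R \<longleftrightarrow>
          [i - i' = 0] (mod int (modulus m)) \<and>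
          (case m of
             enat l \<Rightarrow> (a' \<otimes> inv a, r [^] ((i - i') div int l)) \<in> rcong H
           | \<infinity> \<Rightarrow> a' \<otimes> inv a \<in> H)))"
proof -
  interpret comm_group G by fact
  interpret cyclic_data G n c by unfold_locales fact+
  have X: "X = carrier G \<times> Zmod n" and \<sigma>: "\<sigma> = S_sigma G n c" and \<tau>: "\<tau> = S_tau G n c"
    using assms(6) by (simp_all add: S_solution_def)
  interpret cyclic_relation G n c R
    using assms(7) by unfold_locales (simp add: X)
  show ?thesis
  proof
    assume "yb_congruence X \<sigma> \<tau> R"
    then interpret cyclic_congruence G n c R
      using assms by unfold_locales (simp_all add: X \<sigma> \<tau>)
    obtain s M where s: "s \<in> carrier G" "rel \<one> 0 s (int M)"
      and rel: "\<forall>a\<in>carrier G. \<forall>b\<in>carrier G. \<forall>i j. rel a i b j \<longleftrightarrow>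
        int M dvd i - j \<and> a \<otimes> inv b \<otimes> inv s [^] ((i - j) div int M) \<in> H"
      by (rule coset_description)
    define m where "m = (if M = 0 then \<infinity> else enat M)"
    have m: "modulus m = M"
      by (simp add: m_def modulus_def)
    have m_pos: "0 < m"
      by (simp add: m_def zero_enat_def)
    have m_enat: "l = M \<and> l \<noteq> 0" if "m = enat l" for l
      using that by (auto simp: m_def split: if_splits)
    \<comment> \<open>Conditions (i) and (iii) are both read off from the fact that
      \<open>(\<one>, 0)\<close> and its shift by \<open>modulus n\<close> are related.\<close>
    have wrap: "int M dvd int (modulus n) \<and> inv s [^] (int (modulus n) div int M) \<in> H"
      using rel_sym[OF rel_modulus[of \<one> 0]] s(1) by (simp add: rel)
    have i: "\<exists>l. m = enat l \<and> l dvd k" if "n = enat k" for k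
    proof -
      \<comment> \<open>Since \<open>k\<close> is non-zero, divisibility rules out
        \<open>M = 0\<close>; so \<open>m\<close> is finite.\<close>
      have "M dvd k" "k \<noteq> 0"
        using wrap n_pos that by (simp_all add: modulus_def zero_enat_def)
      then show ?thesis
        by (intro exI[of _ M]) (auto simp: m_def)
    qed
    have ii: "c i \<otimes> inv (c (residue n (i + int l))) \<in> H" if "m = enat l" "i \<in> Zmod n" for l i
      \<comment> \<open>The shifted relation between \<open>(\<one>, i)\<close> and
        \<open>(s, M + i)\<close> compares the values of \<open>d\<close> at these two
        indices.\<close>
      using d_diff_in_H[OF rel_shift[OF s(2), of i]] m_enat[OF that(1)] residue_id[OF that(2)]
      by (simp add: d_def add.commute)
    have iii: "inv s [^] (k div l) \<in> H" if "n = enat k" "m = enat l" for k l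
    proof -
      have "inv s [^] (int k div int l) \<in> H"
        using wrap m_enat[OF that(2)] that(1) by (simp add: modulus_def)
      then show ?thesis
        by (simp add: int_pow_int flip: zdiv_int)
    qed
    have iv: "((a, i), (a', i')) \<in> R \<longleftrightarrow>
          [i - i' = 0] (mod int (modulus m)) \<and>
          (case m of
             enat l \<Rightarrow> (a' \<otimes> inv a, inv s [^] ((i - i') div int l)) \<in> rcong H
           | \<infinity> \<Rightarrow> a' \<otimes> inv a \<in> H)"
      if "a \<in> carrier G" "a' \<in> carrier G" "i \<in> Zmod n" "i' \<in> Zmod n" for a a' i i'
      unfolding coset_condition_iff[OF subgroup_H inv_closed[OF s(1)] that(1,2)]
      using rel[rule_format, OF that(1,2), of i i']
      by (simp only: rel_def residue_id[OF that(3)] residue_id[OF that(4)] m)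
    show "\<exists>H m r. subgroup H G \<and> 0 < m \<and> r \<in> carrier G \<and>
       (\<forall>k. n = enat k \<longrightarrow> (\<exists>l. m = enat l \<and> l dvd k)) \<and>
       (\<forall>l. m = enat l \<longrightarrow> (\<forall>i\<in>Zmod n. c i \<otimes> inv (c (residue n (i + int l))) \<in> H)) \<and>
       (\<forall>k l. n = enat k \<longrightarrow> m = enat l \<longrightarrow> r [^] (k div l) \<in> H) \<and>
       (\<forall>a\<in>carrier G. \<forall>a'\<in>carrier G. \<forall>i\<in>Zmod n. \<forall>i'\<in>Zmod n.
          ((a, i), (a', i')) \<in> R \<longleftrightarrow>
          [i - i' = 0] (mod int (modulus m)) \<and>
          (case m of
             enat l \<Rightarrow> (a' \<otimes> inv a, r [^] ((i - i') div int l)) \<in> rcong H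
           | \<infinity> \<Rightarrow> a' \<otimes> inv a \<in> H))"
      by (intro exI[of _ H] exI[of _ m] exI[of _ "inv s"] conjI allI ballI impI
          subgroup_H m_pos inv_closed[OF s(1)] i ii iii iv)
  next
    assume "\<exists>H m r. subgroup H G \<and> 0 < m \<and> r \<in> carrier G \<and>
       (\<forall>k. n = enat k \<longrightarrow> (\<exists>l. m = enat l \<and> l dvd k)) \<and>
       (\<forall>l. m = enat l \<longrightarrow> (\<forall>i\<in>Zmod n. c i \<otimes> inv (c (residue n (i + int l))) \<in> H)) \<and>
       (\<forall>k l. n = enat k \<longrightarrow> m = enat l \<longrightarrow> r [^] (k div l) \<in> H) \<and>
       (\<forall>a\<in>carrier G. \<forall>a'\<in>carrier G. \<forall>i\<in>Zmod n. \<forall>i'\<in>Zmod n.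
          ((a, i), (a', i')) \<in> R \<longleftrightarrow>
          [i - i' = 0] (mod int (modulus m)) \<and>
          (case m of
             enat l \<Rightarrow> (a' \<otimes> inv a, r [^] ((i - i') div int l)) \<in> rcong H
           | \<infinity> \<Rightarrow> a' \<otimes> inv a \<in> H))"
    then obtain H m r where H: "subgroup H G" and r: "r \<in> carrier G"
      and i: "\<forall>k. n = enat k \<longrightarrow> (\<exists>l. m = enat l \<and> l dvd k)"
      and ii: "\<forall>l. m = enat l \<longrightarrow>
        (\<forall>i\<in>Zmod n. c i \<otimes> inv (c (residue n (i + int l))) \<in> H)"
      and iii: "\<forall>k l. n = enat k \<longrightarrow> m = enat l \<longrightarrow> r [^] (k div l) \<in> H"
      and iv: "\<forall>a\<in>carrier G. \<forall>a'\<in>carrier G. \<forall>i\<in>Zmod n. \<forall>i'\<in>Zmod n.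
          ((a, i), (a', i')) \<in> R \<longleftrightarrow>
          [i - i' = 0] (mod int (modulus m)) \<and>
          (case m of
             enat l \<Rightarrow> (a' \<otimes> inv a, r [^] ((i - i') div int l)) \<in> rcong H
           | \<infinity> \<Rightarrow> a' \<otimes> inv a \<in> H)"
      by (elim exE conjE) (rule that)
    interpret H: subgroup H G by (rule H)
    \<comment> \<open>For infinite \<open>n\<close> the modulus is \<open>0\<close>, so this
      divisibility is trivial and the exponent in \<open>rH\<close> is \<open>0\<close>.\<close>
    have dvd: "int (modulus m) dvd int (modulus n)"
      using i by (cases n) (auto simp: modulus_def)
    have rH: "r [^] (modulus n div modulus m) \<in> H"
      using i iii by (cases n) (auto simp: modulus_def)
    have dM: "d i \<otimes> inv (d (i + int (modulus m))) \<in> H" for i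
    proof (cases m)
      case (enat l)
      then show ?thesis
        using ii[rule_format, OF enat, of "residue n i"] by (simp add: d_def residue_shift modulus_def)
    qed (simp add: modulus_def)
    have dH: "d i \<otimes> inv (d j) \<in> H" if ij: "int (modulus m) dvd i - j" for i j
    proof -
      obtain p where "j - i = int (modulus m) * p"
        using ij by (metis dvd_def dvd_diff_commute)
      then have j: "j = i + int (modulus m) * p"
        by simp
      \<comment> \<open>Telescoping in steps of \<open>modulus m\<close>: upwards with
        \<open>dM\<close>, downwards with its inverse.\<close>
      have "d i \<otimes> inv (d (i + int (modulus m) * q)) \<in> H" for q
      proof (induction q rule: int_induct[where k = 0])
        case (step1 q)
        from H.m_closed[OF this(2) dM[of "i + int (modulus m) * q"]] show ?case
          by (simp add: m_assoc cancel_left algebra_simps)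
      next
        case (step2 q)
        from H.m_closed[OF this(2) H.m_inv_closed[OF dM[of "i + int (modulus m) * (q - 1)"]]]
        show ?case
          by (simp add: inv_mult m_assoc cancel_left2 algebra_simps)
      qed simp
      then show ?thesis
        by (simp add: j)
    qed
    have rel: "rel a i b j \<longleftrightarrow>
        int (modulus m) dvd i - j \<and> a \<otimes> inv b \<otimes> r [^] ((i - j) div int (modulus m)) \<in> H"
      if "a \<in> carrier G" "b \<in> carrier G" for a b i j
      by (rule rel_iff_of_representatives[OF H r dvd rH _ that])
        (simp only: iv[rule_format] coset_condition_iff[OF H r])
    show "yb_congruence X \<sigma> \<tau> R"
      unfolding X \<sigma> by (rule congruence_of_coset_relation[OF H r]) (fact dH, fact rel)
  qed
qed

end
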